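(* Let $\beta\in\mathbb{R}\setminus\{0,-1,1\}$. (a) The solutions $f,g:\mathbb{R}\to\mathbb{C}$ of the functional equation $$g(x+\beta y)=g(x)g(y)+f(x)f(y),\quad x,y\in\mathbb{R},$$ are exactly the following pairs of (constant) functions: 1) $f=0$ and $g=0$; 2) $f=\dfrac{\alpha}{1+\alpha^2}$ and $g=\dfrac{1}{1+\alpha^2}$, where $\alpha\in\mathbb{C}\setminus\{i,-i\}$; 3) $f=0$ and $g=1$. (b) The solutions $f,g:\mathbb{R}\to\mathbb{C}$ of the functional equation $$f(x+\beta y)=f(x)g(y)+f(y)g(x),\quad x,y\in\mathbb{R},$$ are exactly the following pairs: 1) $f=0$ and $g$ is arbitrary; 2) $f=\dfrac{1}{2\alpha}$ and $g=\dfrac12$ (constant functions), where $\alpha\in\mathbb{C}\setminus\{0\}$.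
   Context: No regularity (such as continuity) is assumed on $f$ and $g$. *)

theory Defs
  imports Complex_Main
begin

end

theory Submission
  imports Defs
begin

text \<open>
  In both equations the right-hand side is symmetric in \<open>x\<close> and \<open>y\<close>, so the function \<open>h\<close> on the
  left satisfies \<open>h (x + \<beta> * y) = h (y + \<beta> * x)\<close>. Because \<open>\<beta>\<^sup>2 \<noteq> 1\<close>, the linear map sending
  \<open>(x, y)\<close> to \<open>(x + \<beta> * y, y + \<beta> * x)\<close> is onto the plane, and hence \<open>h\<close> is constant
  (\<open>const_if_symmetric\<close>). What remains is algebra with the other function:
  in (a) the products \<open>f x * f y\<close> do not depend on \<open>x\<close> and \<open>y\<close>, which makes \<open>f\<close> constant
  (\<open>const_if_products_const\<close>); in (b), unless \<open>f = 0\<close>, cancelling the constant value of \<open>f\<close>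
  leaves \<open>g x + g y = 1\<close>.
\<close>

lemma const_if_symmetric:
  fixes h :: "'a::field \<Rightarrow> 'b"
  assumes "\<beta> \<notin> {-1, 1}"
    and sym: "\<And>x y. h (x + \<beta> * y) = h (y + \<beta> * x)"
  shows "h u = h v"
proof -
  have "\<beta>\<^sup>2 \<noteq> 1"
    using assms(1) by (simp add: power2_eq_1_iff)
  hence d: "1 - \<beta>\<^sup>2 \<noteq> 0"
    by simp
  \<comment> \<open>Cramer's rule for the system \<open>x + \<beta> * y = u\<close>, \<open>y + \<beta> * x = v\<close>, of determinant \<open>1 - \<beta>\<^sup>2\<close>.\<close>
  define x where "x = (u - \<beta> * v) / (1 - \<beta>\<^sup>2)"
  define y where "y = (v - \<beta> * u) / (1 - \<beta>\<^sup>2)"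
  have "x + \<beta> * y = (u * (1 - \<beta>\<^sup>2)) / (1 - \<beta>\<^sup>2)"
    "y + \<beta> * x = (v * (1 - \<beta>\<^sup>2)) / (1 - \<beta>\<^sup>2)"
    unfolding x_def y_def
    by (simp_all add: algebra_simps power2_eq_square flip: add_divide_distrib)
  hence "x + \<beta> * y = u" "y + \<beta> * x = v"
    using d by simp_all
  with sym[of x y] show ?thesis
    by simp
qed

lemma const_if_products_const:
  fixes f :: "'a \<Rightarrow> 'b::idom"
  assumes "\<And>x y. f x * f y = k"
  shows "f x = f z"
proof (cases "f z = 0")
  case True
  hence "f x * f x = 0"
    using assms[of x x] assms[of z z] by simp
  thus ?thesis
    using True by simp
next
  case False
  have "f x * f z = f z * f z"
    using assms by simp
  thus ?thesis
    using False by simp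
qed

text \<open>
  The points \<open>(c, d)\<close> of the conic \<open>d = d\<^sup>2 + c\<^sup>2\<close> are parametrised by the slope \<open>\<alpha> = c / d\<close> of the
  line joining them to the origin; the origin itself is the only point with \<open>d = 0\<close>. The excluded
  slopes \<open>\<plusminus>\<i>\<close> are those of the isotropic lines, which meet the conic only at the origin.
\<close>

lemma conic_slope_parametrisation:
  fixes c d :: complex
  assumes eq: "d = d * d + c * c" and "d \<noteq> 0"
  obtains \<alpha> where "\<alpha> \<notin> {\<i>, - \<i>}" "c = \<alpha> / (1 + \<alpha>\<^sup>2)" "d = 1 / (1 + \<alpha>\<^sup>2)"
proof
  have "d * (1 + (c / d)\<^sup>2) = (d * d + c * c) / d"
    using \<open>d \<noteq> 0\<close> by (simp add: field_simps power2_eq_square)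
  also have "\<dots> = 1"
    using eq \<open>d \<noteq> 0\<close> by simp
  finally have one: "d * (1 + (c / d)\<^sup>2) = 1" .
  hence nz: "1 + (c / d)\<^sup>2 \<noteq> 0"
    by auto
  thus "c / d \<notin> {\<i>, - \<i>}"
    by auto
  show d: "d = 1 / (1 + (c / d)\<^sup>2)"
    using one nz by (simp add: eq_divide_eq)
  have "c = (c / d) * d"
    using \<open>d \<noteq> 0\<close> by simp
  also have "\<dots> = (c / d) * (1 / (1 + (c / d)\<^sup>2))"
    using d by simp
  finally show "c = (c / d) / (1 + (c / d)\<^sup>2)"
    by simp
qed

lemma one_plus_square_nonzero:
  fixes \<alpha> :: complex
  assumes "\<alpha> \<notin> {\<i>, - \<i>}"
  shows "1 + \<alpha>\<^sup>2 \<noteq> 0"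
proof
  assume "1 + \<alpha>\<^sup>2 = 0"
  hence "(\<alpha> - \<i>) * (\<alpha> + \<i>) = 0"
    by (simp add: algebra_simps power2_eq_square)
  thus False
    using assms by (auto simp: add_eq_0_iff2)
qed

lemma cosine_type_solutions:
  fixes f g :: "real \<Rightarrow> complex"
  assumes \<beta>: "\<beta> \<notin> {-1, 1}"
  shows "(\<forall>x y. g (x + \<beta> * y) = g x * g y + f x * f y) \<longleftrightarrow>
    ((f = (\<lambda>x. 0) \<and> g = (\<lambda>x. 0)) \<or>
     (\<exists>\<alpha>. \<alpha> \<notin> {\<i>, - \<i>} \<and>
        f = (\<lambda>x. \<alpha> / (1 + \<alpha>\<^sup>2)) \<and> g = (\<lambda>x. 1 / (1 + \<alpha>\<^sup>2))) \<or>
     (f = (\<lambda>x. 0) \<and> g = (\<lambda>x. 1)))"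
    (is "?eq \<longleftrightarrow> ?zero \<or> ?family \<or> ?one")
proof
  assume ?eq
  hence eq: "g (x + \<beta> * y) = g x * g y + f x * f y" for x y
    by blast
  have "g (x + \<beta> * y) = g (y + \<beta> * x)" for x y
    by (simp add: eq algebra_simps)
  hence g: "g x = g 0" for x
    by (rule const_if_symmetric[OF \<beta>])
  have prods: "f x * f y = g 0 - g 0 * g 0" for x y
    using eq[of x y] by (simp add: g[of "x + \<beta> * y"] g[of x] g[of y] eq_diff_eq add.commute)
  have f: "f x = f 0" for x
    by (rule const_if_products_const[OF prods])
  have f_fun: "f = (\<lambda>x. f 0)" and g_fun: "g = (\<lambda>x. g 0)"
    using f g by blast+
  have conic: "g 0 = g 0 * g 0 + f 0 * f 0"
    using prods[of 0 0] by simp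
  show "?zero \<or> ?family \<or> ?one"
  proof (cases "g 0 = 0")
    case True
    hence "f 0 = 0"
      using conic by simp
    thus ?thesis
      using True f_fun g_fun by auto
  next
    case False
    then obtain \<alpha> where "\<alpha> \<notin> {\<i>, - \<i>}" "f 0 = \<alpha> / (1 + \<alpha>\<^sup>2)" "g 0 = 1 / (1 + \<alpha>\<^sup>2)"
      using conic_slope_parametrisation[OF conic] by blast
    hence ?family
      using f_fun g_fun by metis
    thus ?thesis
      by blast
  qed
next
  assume "?zero \<or> ?family \<or> ?one"
  thus ?eq
  proof (elim disjE exE conjE)
    fix \<alpha>
    assume \<alpha>: "\<alpha> \<notin> {\<i>, - \<i>}"
      and fg: "f = (\<lambda>x. \<alpha> / (1 + \<alpha>\<^sup>2))" "g = (\<lambda>x. 1 / (1 + \<alpha>\<^sup>2))"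
    define s where "s = 1 + \<alpha>\<^sup>2"
    have "s \<noteq> 0"
      unfolding s_def by (rule one_plus_square_nonzero[OF \<alpha>])
    have "(1 / s) * (1 / s) + (\<alpha> / s) * (\<alpha> / s) = (1 + \<alpha>\<^sup>2) / (s * s)"
      by (simp add: add_divide_distrib power2_eq_square)
    also have "\<dots> = 1 / s"
      using \<open>s \<noteq> 0\<close> by (simp flip: s_def)
    finally show ?eq
      unfolding fg by (simp flip: s_def)
  qed simp_all
qed

lemma sine_type_solutions:
  fixes f g :: "real \<Rightarrow> complex"
  assumes \<beta>: "\<beta> \<notin> {-1, 1}"
  shows "(\<forall>x y. f (x + \<beta> * y) = f x * g y + f y * g x) \<longleftrightarrow>
    (f = (\<lambda>x. 0) \<or>
     (\<exists>\<alpha>. \<alpha> \<noteq> 0 \<and> f = (\<lambda>x. 1 / (2 * \<alpha>)) \<and> g = (\<lambda>x. 1 / 2)))"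
    (is "?eq \<longleftrightarrow> ?zero \<or> ?family")
proof
  assume ?eq
  hence eq: "f (x + \<beta> * y) = f x * g y + f y * g x" for x y
    by blast
  have "f (x + \<beta> * y) = f (y + \<beta> * x)" for x y
    by (simp add: eq algebra_simps)
  hence f: "f x = f 0" for x
    by (rule const_if_symmetric[OF \<beta>])
  show "?zero \<or> ?family"
  proof (cases "f 0 = 0")
    case True
    thus ?thesis
      using f by auto
  next
    case False
    have g: "g x = 1 / 2" for x
    proof -
      have "f 0 * 1 = f 0 * (2 * g x)"
        using eq[of x x] f[of x] f[of "x + \<beta> * x"] by simp
      hence "2 * g x = 1"
        using False by simp
      thus ?thesis
        by (simp add: eq_divide_eq mult.commute)
    qed
    have "1 / (2 * f 0) \<noteq> 0 \<and> f = (\<lambda>x. 1 / (2 * (1 / (2 * f 0)))) \<and> g = (\<lambda>x. 1 / 2)"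
      using False f g by auto
    thus ?thesis
      by blast
  qed
next
  assume "?zero \<or> ?family"
  thus ?eq
    by auto
qed

theorem mainTheorem6:
  fixes \<beta> :: real
  assumes "\<beta> \<notin> {0, -1, 1}"
  shows
    "(\<forall>f g :: real \<Rightarrow> complex.
        (\<forall>x y. g (x + \<beta> * y) = g x * g y + f x * f y) \<longleftrightarrow>
        ((f = (\<lambda>x. 0) \<and> g = (\<lambda>x. 0)) \<or>
         (\<exists>\<alpha>. \<alpha> \<notin> {\<i>, - \<i>} \<and>
            f = (\<lambda>x. \<alpha> / (1 + \<alpha>\<^sup>2)) \<and> g = (\<lambda>x. 1 / (1 + \<alpha>\<^sup>2))) \<or>
         (f = (\<lambda>x. 0) \<and> g = (\<lambda>x. 1)))) \<and>
     (\<forall>f g :: real \<Rightarrow> complex.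
        (\<forall>x y. f (x + \<beta> * y) = f x * g y + f y * g x) \<longleftrightarrow>
        (f = (\<lambda>x. 0) \<or>
         (\<exists>\<alpha>. \<alpha> \<noteq> 0 \<and> f = (\<lambda>x. 1 / (2 * \<alpha>)) \<and> g = (\<lambda>x. 1 / 2))))"
  using assms by (intro conjI allI cosine_type_solutions sine_type_solutions) simp_all

end
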